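(* Let $\xi,x\in[0,1]$. Then $$S(\xi,x)=\frac{\kappa}{1-\kappa}-2\sum_{\ell=1}^\infty\kappa^{\tau^0_\ell+1}=\sum_{n=0}^\infty\big(1_{\{\bar\xi_{-n}=0\}}-1_{\{\bar\xi_{-n}=1\}}\big)\kappa^{n+1}.$$
   Context: $\gamma\in(1/2,1)$, $\kappa=\frac1{2\gamma}$; $\Phi(y)=d(y,\mathbb{Z})$ is the distance to the nearest integer. Write $\xi=\sum_{n\ge0}\bar\xi_{-n}2^{-(n+1)}$ with digits in $\{0,1\}$ (when there are two expansions, the one not ending in zeros). The second component of the $n$-th iterate ($n\ge1$) of the baker transformation is $$B_2^n(\xi,x)=\frac{\bar\xi_{-n+1}}{2}+\frac{\bar\xi_{-n+2}}{2^2}+\cdots+\frac{\bar\xi_0}{2^n}+\frac{x}{2^n}.$$ $S(\xi,x)=\sum_{n=1}^\infty\kappa^n\Phi'(B_2^n(\xi,x))$, where $\Phi'=1$ on the first half and $-1$ on the second half of $[0,1]$; at the breakpoints $\Phi'(B_2^n(\xi,x))$ is read off from the leading digit, i.e. it is $1$ if $\bar\xi_{-n+1}=0$ and $-1$ if $\bar\xi_{-n+1}=1$. $(\tau^0_\ell)_{\ell\ge1}$ are the successive indices at which the digits of $\xi$ differ from those of $0$: $\tau^0_1=\inf\{j\ge0:\bar\xi_{-j}\neq0\}$, $\tau^0_{\ell+1}=\inf\{j>\tau^0_\ell:\bar\xi_{-j}\neq0\}$, with $\inf\emptyset=\infty$ and $\kappa^\infty=0$. *)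

theory Defs
  imports "HOL-Analysis.Analysis" "HOL-Library.Extended_Nat"
begin

definition binary_expansion :: "real \<Rightarrow> (nat \<Rightarrow> nat) \<Rightarrow> bool" where
  "binary_expansion \<xi> d \<longleftrightarrow>
     (\<forall>n. d n \<in> {0, 1}) \<and> (\<lambda>n. real (d n) / 2 ^ (n + 1)) sums \<xi>"

text \<open>
  \<open>digit \<xi> n\<close> is the digit with subscript \<open>-n\<close> in the mathematical notation. If \<open>\<xi>\<close> has two
  expansions, exactly one of them ends in zeros, and the other one is selected. The number 0
  has only one expansion in \<open>[0,1]\<close>, which is the constant 0.
\<close>
definition digit :: "real \<Rightarrow> nat \<Rightarrow> nat" where
  "digit \<xi> = (THE d. binary_expansion \<xi> d \<and>
     ((\<exists>e. binary_expansion \<xi> e \<and> e \<noteq> d) \<longrightarrow> \<not> (\<exists>N. \<forall>n\<ge>N. d n = 0)))"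

text \<open>Second component of the \<open>n\<close>-th iterate of the baker transformation, for \<open>n \<ge> 1\<close>.\<close>
definition B2 :: "nat \<Rightarrow> real \<Rightarrow> real \<Rightarrow> real" where
  "B2 n \<xi> x = (\<Sum>j=1..n. real (digit \<xi> (n - j)) / 2 ^ j) + x / 2 ^ n"

definition Phi :: "real \<Rightarrow> real" where
  "Phi y = infdist y \<int>"

text \<open>
  The value of \<open>\<Phi>'\<close> at \<open>B2 n \<xi> x\<close>, for \<open>n \<ge> 1\<close>. The breakpoints of \<open>\<Phi>\<close> are the half-integers
  and integers; there the value is read off from the leading digit of \<open>B2 n \<xi> x\<close>, so it
  depends on \<open>n\<close> and \<open>\<xi>\<close> and not only on the point.
\<close>
definition dPhi_B2 :: "nat \<Rightarrow> real \<Rightarrow> real \<Rightarrow> real" where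
  "dPhi_B2 n \<xi> x =
     (if 2 * B2 n \<xi> x \<in> \<int> then (if digit \<xi> (n - 1) = 0 then 1 else - 1)
      else deriv Phi (B2 n \<xi> x))"

text \<open>Summation starts at \<open>n = 1\<close>, hence the shift.\<close>
definition S :: "real \<Rightarrow> real \<Rightarrow> real \<Rightarrow> real" where
  "S \<kappa> \<xi> x = (\<Sum>n. \<kappa> ^ Suc n * dPhi_B2 (Suc n) \<xi> x)"

text \<open>
  Only indices \<open>\<ge> 1\<close> are meaningful; the value at 0 is a dummy. In \<^typ>\<open>enat\<close> the infimum of the
  empty set is \<open>\<infinity>\<close>.
\<close>
fun tau0 :: "real \<Rightarrow> nat \<Rightarrow> enat" where
  "tau0 \<xi> 0 = 0"
| "tau0 \<xi> (Suc 0) = Inf {enat j | j. digit \<xi> j \<noteq> 0}"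
| "tau0 \<xi> (Suc (Suc l)) = Inf {enat j | j. enat j > tau0 \<xi> (Suc l) \<and> digit \<xi> j \<noteq> 0}"

definition epow :: "real \<Rightarrow> enat \<Rightarrow> real" where
  "epow \<kappa> e = (case e of enat n \<Rightarrow> \<kappa> ^ n | \<infinity> \<Rightarrow> 0)"

end

theory Submission imports Defs begin

text \<open>
  The leading digit of \<open>B2 n \<xi> x\<close> decides in which half of \<open>[0,1]\<close> this point lies, because the
  remaining digits and \<open>x\<close> contribute at most \<open>1/2\<close>. Hence every term of \<open>S\<close> is
  \<open>\<plusminus>\<kappa> ^ n\<close> with the sign given by that digit. The sum of \<open>\<kappa> ^ (n + 1)\<close> over the nonzero digits
  becomes the sum over the \<open>\<tau>\<close> by reindexing: the finite values of \<open>tau0 \<xi>\<close> enumerate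
  the positions of the nonzero digits without repetition.
\<close>

section \<open>Existence of binary expansions and the choice made by \<open>digit\<close>\<close>

lemma binary_expansion_term_le:
  assumes "binary_expansion \<xi> d"
  shows "d n \<le> 1"
  using assms unfolding binary_expansion_def by (metis insert_iff le_numeral_extra(4) singletonD zero_le)

text \<open>The digits are read off from the floors of \<open>2 ^ n * \<xi>\<close>. The point 1 is
  treated apart, with all digits 1, because the floors would give it integer part 1 and only zero
  digits.\<close>

lemma binary_expansion_exists:
  assumes "\<xi> \<in> {0..1}"
  shows "\<exists>d. binary_expansion \<xi> d"
proof (cases "\<xi> = 1")
  case True
  have "(\<lambda>n. real 1 / 2 ^ (n + 1)) sums 1"
    using power_half_series by (simp add: power_one_over)
  then show ?thesis
    unfolding binary_expansion_def True by (intro exI[of _ "\<lambda>_. 1"]) simp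
next
  case False
  with assms have \<xi>: "0 \<le> \<xi>" "\<xi> < 1" by auto
  \<comment> \<open>The floor of \<open>2 * y\<close> exceeds twice the floor of \<open>y\<close> by
    0 or 1, so this is a digit. The partial sums telescope to
    \<open>\<lfloor>2 ^ N * \<xi>\<rfloor> / 2 ^ N\<close>, since
    \<open>\<lfloor>\<xi>\<rfloor> = 0\<close>.\<close>
  define d where "d n = nat (\<lfloor>2 ^ (n + 1) * \<xi>\<rfloor> - 2 * \<lfloor>2 ^ n * \<xi>\<rfloor>)" for n
  have step: "\<lfloor>2 ^ (n + 1) * \<xi>\<rfloor> - 2 * \<lfloor>2 ^ n * \<xi>\<rfloor> \<in> {0, 1}" for n
  proof -
    have "2 ^ (n + 1) * \<xi> = 2 * (2 ^ n * \<xi>)" by simp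
    then show ?thesis by (simp only: insert_iff empty_iff) linarith
  qed
  have dn: "real (d n) = \<lfloor>2 ^ (n + 1) * \<xi>\<rfloor> - 2 * \<lfloor>2 ^ n * \<xi>\<rfloor>" for n
    using step[of n] unfolding d_def by auto
  have part: "(\<Sum>n<N. real (d n) / 2 ^ (n + 1)) = \<lfloor>2 ^ N * \<xi>\<rfloor> / 2 ^ N" for N
  proof (induction N)
    case 0
    have "\<lfloor>\<xi>\<rfloor> = 0" using \<xi> by (simp add: floor_eq_iff)
    then show ?case by simp
  next
    case (Suc N)
    then show ?case by (simp add: dn field_simps)
  qed
  have "(\<lambda>N. \<lfloor>2 ^ N * \<xi>\<rfloor> / 2 ^ N) \<longlonglongrightarrow> \<xi>"
  proof (rule tendsto_sandwich)
    show "\<forall>\<^sub>F N in sequentially. \<xi> - (1/2) ^ N \<le> \<lfloor>2 ^ N * \<xi>\<rfloor> / 2 ^ N"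
    proof (intro always_eventually allI)
      fix N
      have "2 ^ N * \<xi> - 1 \<le> \<lfloor>2 ^ N * \<xi>\<rfloor>" by linarith
      then show "\<xi> - (1/2) ^ N \<le> \<lfloor>2 ^ N * \<xi>\<rfloor> / 2 ^ N"
        by (simp add: power_one_over le_divide_eq right_diff_distrib mult.commute)
    qed
    show "\<forall>\<^sub>F N in sequentially. \<lfloor>2 ^ N * \<xi>\<rfloor> / 2 ^ N \<le> \<xi>"
      by (intro always_eventually allI) (simp add: divide_le_eq mult.commute)
    have "(\<lambda>N. \<xi> - (1/2) ^ N) \<longlonglongrightarrow> \<xi> - 0"
      by (intro tendsto_intros) auto
    then show "(\<lambda>N. \<xi> - (1/2) ^ N) \<longlonglongrightarrow> \<xi>" by simp
  qed simp
  then have "(\<lambda>n. real (d n) / 2 ^ (n + 1)) sums \<xi>"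
    unfolding sums_def part .
  moreover have "d n \<in> {0, 1}" for n
    using step[of n] unfolding d_def by auto
  ultimately show ?thesis unfolding binary_expansion_def by blast
qed

text \<open>At the first disagreement \<open>d\<close> gains \<open>1 / 2 ^ (k + 1)\<close> over
  \<open>e\<close>. The later digits can make up at most this amount, and only in the extreme
  case.\<close>

lemma binary_expansion_tails:
  assumes d: "binary_expansion \<xi> d" and e: "binary_expansion \<xi> e"
    and eq: "\<And>n. n < k \<Longrightarrow> d n = e n" and k: "d k = 1" "e k = 0" and n: "n > k"
  shows "d n = 0" "e n = 1"
proof -
  have le: "d m \<le> 1" "e m \<le> 1" for m
    using binary_expansion_term_le[OF d] binary_expansion_term_le[OF e] by auto
  \<comment> \<open>A tail of ones adds up to \<open>1 / 2 ^ Suc k\<close>, exactly the gap at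
    \<open>k\<close>. Hence the nonnegative terms \<open>f j\<close> sum to 0 and all
    vanish.\<close>
  define f where "f j = (1 + real (d (j + Suc k)) - real (e (j + Suc k))) / 2 ^ (j + Suc k + 1)" for j
  have tail: "(\<lambda>j. real (c (j + Suc k)) / 2 ^ (j + Suc k + 1)) sums
                (\<xi> - (\<Sum>i<Suc k. real (c i) / 2 ^ (i + 1)))"
    if "binary_expansion \<xi> c" for c
    using that sums_split_initial_segment[of "\<lambda>n. real (c n) / 2 ^ (n + 1)" \<xi> "Suc k"]
    unfolding binary_expansion_def by blast
  have "(\<lambda>j. (1/2) ^ Suc j * (1 / 2 ^ Suc k)) sums (1 * (1 / 2 ^ Suc k) :: real)"
    by (intro sums_mult2 power_half_series)
  then have "(\<lambda>j. 1 / 2 ^ (j + Suc k + 1)) sums (1 / 2 ^ Suc k :: real)"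
    by (simp add: power_add field_simps)
  from sums_diff[OF sums_add[OF this tail[OF d]] tail[OF e]]
  have "f sums 0"
    using eq k unfolding f_def by (simp add: add_divide_distrib diff_divide_distrib)
  moreover have nonneg: "f j \<ge> 0" for j
    using le(2)[of "j + Suc k"] unfolding f_def by (intro divide_nonneg_nonneg) auto
  ultimately have "f j = 0" for j
    using suminf_eq_zero_iff[of f] by (simp add: sums_iff)
  from this[of "n - Suc k"] n have "1 + real (d n) - real (e n) = 0"
    unfolding f_def by (auto simp del: power_Suc)
  then show "d n = 0" "e n = 1" using le[of n] by linarith+
qed

text \<open>After the first disagreement one expansion is constantly 0 and the other constantly 1.
  This makes the selection rule in \<open>digit\<close> unambiguous.\<close>

lemma distinct_binary_expansions:
  assumes d: "binary_expansion \<xi> d" and e: "binary_expansion \<xi> e" and "d \<noteq> e"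
  shows "(\<exists>N. \<forall>n\<ge>N. d n = 0) \<longleftrightarrow> \<not> (\<exists>N. \<forall>n\<ge>N. e n = 0)"
proof -
  \<comment> \<open>Kept general in \<open>a\<close> and \<open>b\<close>, since either expansion
    may carry the 1 at the first disagreement.\<close>
  have main: "(\<exists>N. \<forall>n\<ge>N. a n = 0) \<and> \<not> (\<exists>N. \<forall>n\<ge>N. b n = 0)"
    if a: "binary_expansion \<xi> a" and b: "binary_expansion \<xi> b"
      and eq: "\<And>n. n < k \<Longrightarrow> a n = b n" and k: "a k = 1" "b k = 0" for a b and k :: nat
  proof
    note tails = binary_expansion_tails[OF a b eq k]
    show "\<exists>N. \<forall>n\<ge>N. a n = 0" by (rule exI[of _ "Suc k"]) (simp add: tails)
    show "\<not> (\<exists>N. \<forall>n\<ge>N. b n = 0)"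
    proof
      assume "\<exists>N. \<forall>n\<ge>N. b n = 0"
      then obtain N where "\<forall>n\<ge>N. b n = 0" by blast
      then have "b (N + Suc k) = 0" by simp
      moreover have "b (N + Suc k) = 1" by (rule tails) simp_all
      ultimately show False by simp
    qed
  qed
  define k where "k = (LEAST n. d n \<noteq> e n)"
  have "\<exists>n. d n \<noteq> e n" using \<open>d \<noteq> e\<close> by auto
  then have neq: "d k \<noteq> e k" unfolding k_def by (rule LeastI_ex)
  have eq: "d n = e n" if "n < k" for n
    using that not_less_Least unfolding k_def by blast
  have "d k \<in> {0, 1}" "e k \<in> {0, 1}"
    using d e unfolding binary_expansion_def by auto
  with neq consider "d k = 1" "e k = 0" | "e k = 1" "d k = 0" by auto
  then show ?thesis
  proof cases
    case 1
    then show ?thesis using main[OF d e eq] by blast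
  next
    case 2
    then show ?thesis using main[OF e d eq[symmetric]] by blast
  qed
qed

text \<open>Justifies the definite description in \<open>digit\<close>. An expansion violating the
  rule ends in zeros and has a rival, which then obeys it; of two different expansions one ends in
  zeros, so both cannot obey it.\<close>

lemma binary_expansion_digit:
  assumes "\<xi> \<in> {0..1}"
  shows "binary_expansion \<xi> (digit \<xi>)"
proof -
  define P where "P d \<longleftrightarrow> binary_expansion \<xi> d \<and>
     ((\<exists>e. binary_expansion \<xi> e \<and> e \<noteq> d) \<longrightarrow> \<not> (\<exists>N. \<forall>n\<ge>N. d n = 0))" for d
  obtain d where d: "binary_expansion \<xi> d" using binary_expansion_exists[OF assms] by blast
  have "\<exists>d. P d"
  proof (cases "P d")
    case False
    then obtain e where "binary_expansion \<xi> e" "e \<noteq> d" "\<exists>N. \<forall>n\<ge>N. d n = 0"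
      using d unfolding P_def by blast
    then have "P e" using distinct_binary_expansions[OF d] unfolding P_def by metis
    then show ?thesis by blast
  qed blast
  moreover have "d = e" if "P d" "P e" for d e
    using that distinct_binary_expansions[of \<xi> d e] unfolding P_def by metis
  ultimately have "\<exists>!d. P d" by blast
  then have "P (THE d. P d)" by (rule theI')
  then have "binary_expansion \<xi> (THE d. P d)" unfolding P_def by blast
  then show ?thesis unfolding digit_def P_def .
qed

section \<open>The distance to the nearest integer on \<open>{0..1}\<close> and its slopes\<close>

lemma Phi_first_half:
  assumes "0 \<le> y" "y \<le> 1 / 2"
  shows "Phi y = y"
proof (rule antisym)
  show "Phi y \<le> y"
    using infdist_le[of 0 "\<int>" y] assms unfolding Phi_def by simp
  show "y \<le> Phi y"
    unfolding Phi_def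
  proof (subst infdist_notempty)
    show "y \<le> (INF a\<in>\<int>. dist y a)"
    proof (rule cINF_greatest)
      fix a :: real assume "a \<in> \<int>"
      then obtain m where a: "a = of_int m" by (auto elim: Ints_cases)
      show "y \<le> dist y a"
      proof (cases "m \<le> 0")
        case True then show ?thesis using assms a by (simp add: dist_real_def)
      next
        case False
        then have "1 \<le> a" using a by simp
        then show ?thesis using assms by (simp add: dist_real_def)
      qed
    qed auto
  qed auto
qed

lemma Phi_second_half:
  assumes "1 / 2 \<le> y" "y \<le> 1"
  shows "Phi y = 1 - y"
proof (rule antisym)
  show "Phi y \<le> 1 - y"
    using infdist_le[of 1 "\<int>" y] assms unfolding Phi_def by (simp add: dist_real_def)
  show "1 - y \<le> Phi y"
    unfolding Phi_def
  proof (subst infdist_notempty)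
    show "1 - y \<le> (INF a\<in>\<int>. dist y a)"
    proof (rule cINF_greatest)
      fix a :: real assume "a \<in> \<int>"
      then obtain m where a: "a = of_int m" by (auto elim: Ints_cases)
      show "1 - y \<le> dist y a"
      proof (cases "m \<le> 0")
        case True
        then have "a \<le> 0" using a by simp
        then show ?thesis using assms by (simp add: dist_real_def)
      next
        case False
        then have "1 \<le> a" using a by simp
        then show ?thesis using assms by (simp add: dist_real_def)
      qed
    qed auto
  qed auto
qed

text \<open>The strict bounds give an open neighbourhood on which \<open>Phi\<close> is linear; at 0
  and 1/2 it has corners.\<close>

lemma deriv_Phi_first_half:
  assumes "0 < y" "y < 1 / 2"
  shows "deriv Phi y = 1"
proof (rule DERIV_imp_deriv)
  have "((\<lambda>y. y) has_field_derivative 1) (at y)" by simp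
  then show "(Phi has_field_derivative 1) (at y)"
    by (rule has_field_derivative_transform_within_open[where S = "{0<..<1/2}"])
      (use assms in \<open>auto simp: Phi_first_half\<close>)
qed

lemma deriv_Phi_second_half:
  assumes "1 / 2 < y" "y < 1"
  shows "deriv Phi y = - 1"
proof (rule DERIV_imp_deriv)
  have "((\<lambda>y. 1 - y) has_field_derivative - 1) (at y)"
    by (auto intro!: derivative_eq_intros)
  then show "(Phi has_field_derivative - 1) (at y)"
    by (rule has_field_derivative_transform_within_open[where S = "{1/2<..<1}"])
      (use assms in \<open>auto simp: Phi_second_half\<close>)
qed

section \<open>The signs of the terms of \<open>S\<close>\<close>

text \<open>The digits after the leading one contribute at most \<open>1 / 2 - 1 / 2 ^ Suc n\<close>
  and \<open>x\<close> at most \<open>1 / 2 ^ Suc n\<close>, together 1/2.\<close>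

lemma B2_leading_digit:
  assumes "\<xi> \<in> {0..1}" and "x \<in> {0..1}"
  shows "B2 (Suc n) \<xi> x \<in> {real (digit \<xi> n) / 2 .. real (digit \<xi> n) / 2 + 1 / 2}"
proof -
  have le: "digit \<xi> m \<le> 1" for m
    using binary_expansion_digit[OF assms(1)] by (rule binary_expansion_term_le)
  have half: "(\<Sum>j=2..Suc n. 1 / 2 ^ j) = 1 / 2 - (1 / 2 ^ Suc n :: real)" for n
    by (induction n) (auto simp: field_simps)
  define r where "r = (\<Sum>j=2..Suc n. real (digit \<xi> (Suc n - j)) / 2 ^ j)"
  \<comment> \<open>The summand \<open>j = 1\<close> has digit index \<open>Suc n - 1 = n\<close>:
    it is the leading digit.\<close>
  have "{1..Suc n} = insert 1 {2..Suc n}" by auto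
  then have split: "B2 (Suc n) \<xi> x = real (digit \<xi> n) / 2 + r + x / 2 ^ Suc n"
    unfolding B2_def r_def by simp
  have "r \<le> (\<Sum>j=2..Suc n. 1 / 2 ^ j)"
    unfolding r_def by (intro sum_mono divide_right_mono) (use le in auto)
  moreover have "0 \<le> r" unfolding r_def by (intro sum_nonneg) auto
  moreover have "x / 2 ^ Suc n \<le> 1 / 2 ^ Suc n" "0 \<le> x / 2 ^ Suc n"
    using assms(2) by (auto intro!: divide_right_mono)
  ultimately show ?thesis unfolding split half by simp
qed

text \<open>This form of the sign lets \<open>S\<close> split into a geometric series minus twice a
  series over the nonzero digits. At breakpoints it is the convention in
  \<open>dPhi_B2\<close>.\<close>

lemma dPhi_B2_eq:
  assumes "\<xi> \<in> {0..1}" and "x \<in> {0..1}"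
  shows "dPhi_B2 (Suc n) \<xi> x = 1 - 2 * of_bool (digit \<xi> n \<noteq> 0)"
proof (cases "2 * B2 (Suc n) \<xi> x \<in> \<int>")
  case True
  then show ?thesis unfolding dPhi_B2_def by simp
next
  case False
  define b where "b = B2 (Suc n) \<xi> x"
  \<comment> \<open>The end points of the two halves are excluded, so the closed bounds on
    \<open>b\<close> become strict and \<open>Phi\<close> is differentiable there.\<close>
  have "2 * b \<noteq> 0" "2 * b \<noteq> 1" "2 * b \<noteq> 2"
    using False unfolding b_def by (metis Ints_0, metis Ints_1, metis Ints_numeral)
  then have b: "b \<noteq> 0" "b \<noteq> 1 / 2" "b \<noteq> 1" by auto
  note B2 = B2_leading_digit[OF assms, of n, folded b_def]
  have "digit \<xi> n \<le> 1"
    using binary_expansion_digit[OF assms(1)] by (rule binary_expansion_term_le)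
  then consider "digit \<xi> n = 0" | "digit \<xi> n = 1" by linarith
  then have "deriv Phi b = 1 - 2 * of_bool (digit \<xi> n \<noteq> 0)"
  proof cases
    case 1
    then have "0 < b" "b < 1 / 2" using b B2 by auto
    then show ?thesis using 1 by (simp add: deriv_Phi_first_half)
  next
    case 2
    then have "1 / 2 < b" "b < 1" using b B2 by auto
    then show ?thesis using 2 by (simp add: deriv_Phi_second_half)
  qed
  then show ?thesis using False unfolding dPhi_B2_def b_def by simp
qed

section \<open>The values of \<open>tau0\<close> as an enumeration of the nonzero digits\<close>

lemma Inf_enat_mem:
  fixes X :: "enat set"
  assumes "Inf X \<noteq> \<infinity>"
  shows "Inf X \<in> X"
  using assms unfolding Inf_enat_def by (auto split: if_splits intro: LeastI)

lemma tau0_finite: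
  assumes "tau0 \<xi> (Suc l) = enat j"
  shows "digit \<xi> j \<noteq> 0"
proof (cases l)
  case 0
  then show ?thesis
    using assms Inf_enat_mem[of "{enat j | j. digit \<xi> j \<noteq> 0}"] by auto
next
  case (Suc k)
  then show ?thesis
    using assms Inf_enat_mem[of "{enat j | j. enat j > tau0 \<xi> (Suc k) \<and> digit \<xi> j \<noteq> 0}"]
    by auto
qed

lemma tau0_less_Suc:
  assumes "tau0 \<xi> (Suc (Suc l)) \<noteq> \<infinity>"
  shows "tau0 \<xi> (Suc l) < tau0 \<xi> (Suc (Suc l))"
  using assms Inf_enat_mem[of "{enat j | j. enat j > tau0 \<xi> (Suc l) \<and> digit \<xi> j \<noteq> 0}"]
  by auto

lemma tau0_less:
  assumes "k < l" and "tau0 \<xi> (Suc l) \<noteq> \<infinity>"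
  shows "tau0 \<xi> (Suc k) < tau0 \<xi> (Suc l)"
  using assms
proof (induction l)
  case (Suc l)
  have less: "tau0 \<xi> (Suc l) < tau0 \<xi> (Suc (Suc l))"
    using Suc.prems(2) by (rule tau0_less_Suc)
  show ?case
  proof (cases "k = l")
    case False
    \<comment> \<open>By \<open>less\<close> the smaller value is finite, as the induction
      hypothesis requires.\<close>
    then have "tau0 \<xi> (Suc k) < tau0 \<xi> (Suc l)"
      using Suc less by (metis enat_ord_code(6) less_antisym)
    then show ?thesis using less by (rule less_trans)
  qed (use less in simp)
qed simp

text \<open>Finite values rise by at least 1 at each step, so no bound \<open>n\<close> can hold for
  all of them unless \<infinity> is reached.\<close>

lemma enat_le_tau0: "enat l \<le> tau0 \<xi> (Suc l)"
proof (induction l)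
  case (Suc l)
  show ?case
  proof (cases "tau0 \<xi> (Suc (Suc l)) = \<infinity>")
    case False
    from le_less_trans[OF Suc tau0_less_Suc[OF this]] show ?thesis
      by (simp add: Suc_ile_eq)
  qed simp
qed (simp add: zero_enat_def[symmetric])

text \<open>While the values stay below \<open>n\<close>, the position \<open>n\<close> is a
  candidate for the next infimum, which is therefore at most \<open>n\<close>. Never hitting
  \<open>n\<close> would keep all values below it.\<close>

lemma tau0_surj:
  assumes "digit \<xi> n \<noteq> 0"
  shows "\<exists>l. tau0 \<xi> (Suc l) = enat n"
proof (rule ccontr)
  assume none: "\<nexists>l. tau0 \<xi> (Suc l) = enat n"
  have less: "tau0 \<xi> (Suc l) < enat n" for l
  proof (induction l)
    case 0
    have "tau0 \<xi> (Suc 0) \<le> enat n"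
      using assms by (auto intro!: Inf_lower)
    then show ?case using none by (metis order_le_imp_less_or_eq)
  next
    case (Suc l)
    then have "tau0 \<xi> (Suc (Suc l)) \<le> enat n"
      unfolding tau0.simps using assms by (intro Inf_lower) blast
    then show ?case using none by (metis order_le_imp_less_or_eq)
  qed
  \<comment> \<open>The index \<open>l = n\<close> gives
    \<open>n \<le> tau0 \<xi> (Suc n) < n\<close>.\<close>
  from le_less_trans[OF enat_le_tau0 less, of n] show False by simp
qed

lemma bij_betw_tau0:
  "bij_betw (\<lambda>l. the_enat (tau0 \<xi> (Suc l))) {l. tau0 \<xi> (Suc l) \<noteq> \<infinity>} {n. digit \<xi> n \<noteq> 0}"
  unfolding bij_betw_def
proof
  show "inj_on (\<lambda>l. the_enat (tau0 \<xi> (Suc l))) {l. tau0 \<xi> (Suc l) \<noteq> \<infinity>}"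
  proof (rule inj_onI)
    fix k l
    assume "k \<in> {l. tau0 \<xi> (Suc l) \<noteq> \<infinity>}" "l \<in> {l. tau0 \<xi> (Suc l) \<noteq> \<infinity>}"
      and "the_enat (tau0 \<xi> (Suc k)) = the_enat (tau0 \<xi> (Suc l))"
    then have "tau0 \<xi> (Suc k) = tau0 \<xi> (Suc l)" "tau0 \<xi> (Suc k) \<noteq> \<infinity>" "tau0 \<xi> (Suc l) \<noteq> \<infinity>"
      by auto
    then show "k = l" using tau0_less by (metis less_irrefl linorder_neqE_nat)
  qed
  show "(\<lambda>l. the_enat (tau0 \<xi> (Suc l))) ` {l. tau0 \<xi> (Suc l) \<noteq> \<infinity>} = {n. digit \<xi> n \<noteq> 0}"
  proof (intro equalityI subsetI)
    fix n assume "n \<in> {n. digit \<xi> n \<noteq> 0}"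
    then obtain l where "tau0 \<xi> (Suc l) = enat n" using tau0_surj by blast
    then show "n \<in> (\<lambda>l. the_enat (tau0 \<xi> (Suc l))) ` {l. tau0 \<xi> (Suc l) \<noteq> \<infinity>}"
      by (intro image_eqI[of _ _ l]) auto
  qed (auto dest: tau0_finite)
qed

text \<open>Unordered sums may be reindexed along a bijection and are insensitive to zero terms, so
  finitely and infinitely many nonzero digits are handled alike. Writing \<open>Suc l\<close> skips
  the dummy value of \<open>tau0\<close> at 0.\<close>

lemma epow_tau0_sums:
  assumes "0 \<le> \<kappa>" and "\<kappa> < 1"
  shows "(\<lambda>l. epow \<kappa> (tau0 \<xi> (Suc l) + 1)) sums (\<Sum>n. of_bool (digit \<xi> n \<noteq> 0) * \<kappa> ^ (n + 1))"
    (is "_ sums ?s")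
proof -
  let ?A = "{n. digit \<xi> n \<noteq> 0}" and ?L = "{l. tau0 \<xi> (Suc l) \<noteq> \<infinity>}"
  let ?g = "\<lambda>l. the_enat (tau0 \<xi> (Suc l))"
  have "summable (\<lambda>n. \<kappa> ^ (n + 1))"
    using assms summable_geometric[of \<kappa>] by (simp add: summable_mult)
  then have "summable (\<lambda>n. of_bool (digit \<xi> n \<noteq> 0) * \<kappa> ^ (n + 1))"
    by (rule summable_comparison_test'[where N = 0]) (use assms in auto)
  then have "((\<lambda>n. of_bool (digit \<xi> n \<noteq> 0) * \<kappa> ^ (n + 1)) has_sum ?s) UNIV"
    using assms by (intro sums_nonneg_imp_has_sum summable_sums) auto
  then have "((\<lambda>n. \<kappa> ^ (n + 1)) has_sum ?s) ?A"
    by (rule has_sum_cong_neutral[THEN iffD1, rotated -1]) auto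
  then have "((\<lambda>l. \<kappa> ^ (?g l + 1)) has_sum ?s) ?L"
    using has_sum_reindex_bij_betw[OF bij_betw_tau0, of "\<lambda>n. \<kappa> ^ (n + 1)" \<xi> ?s] by simp
  \<comment> \<open>Outside \<open>?L\<close> the exponent is
    \<open>\<infinity> + 1 = \<infinity>\<close>, where \<open>epow\<close> is 0.\<close>
  then have "((\<lambda>l. epow \<kappa> (tau0 \<xi> (Suc l) + 1)) has_sum ?s) UNIV"
    by (rule has_sum_cong_neutral[THEN iffD1, rotated -1])
      (auto simp: epow_def one_enat_def)
  then show ?thesis by (rule has_sum_imp_sums)
qed

theorem corollary3p7:
  fixes \<gamma> \<kappa> \<xi> x :: real
  assumes "1 / 2 < \<gamma>" and "\<gamma> < 1"
    and "\<kappa> = 1 / (2 * \<gamma>)"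
    and "\<xi> \<in> {0..1}" and "x \<in> {0..1}"
  shows "S \<kappa> \<xi> x = \<kappa> / (1 - \<kappa>) - 2 * (\<Sum>l. epow \<kappa> (tau0 \<xi> (Suc l) + 1)) \<and>
         \<kappa> / (1 - \<kappa>) - 2 * (\<Sum>l. epow \<kappa> (tau0 \<xi> (Suc l) + 1)) =
           (\<Sum>n. (of_bool (digit \<xi> n = 0) - of_bool (digit \<xi> n = 1)) * \<kappa> ^ (n + 1))"
proof -
  \<comment> \<open>The bound \<open>1 / 2 < \<gamma>\<close> yields \<open>\<kappa> < 1\<close>,
    hence convergence of all the series.\<close>
  have \<kappa>: "0 \<le> \<kappa>" "\<kappa> < 1" using assms(1,2) unfolding assms(3) by auto
  let ?T = "\<lambda>n. of_bool (digit \<xi> n \<noteq> 0) * \<kappa> ^ (n + 1)"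
  have geo: "(\<lambda>n. \<kappa> ^ (n + 1)) sums (\<kappa> / (1 - \<kappa>))"
    using sums_mult[OF geometric_sums[of \<kappa>], of \<kappa>] \<kappa> by simp
  have "summable ?T"
    by (rule summable_comparison_test'[OF sums_summable[OF geo], where N = 0]) (use \<kappa> in auto)
  then have "(\<lambda>n. \<kappa> ^ (n + 1) - 2 * ?T n) sums (\<kappa> / (1 - \<kappa>) - 2 * suminf ?T)"
    by (intro sums_diff geo sums_mult summable_sums)
  then have T: "(\<Sum>n. (1 - 2 * of_bool (digit \<xi> n \<noteq> 0)) * \<kappa> ^ (n + 1))
      = \<kappa> / (1 - \<kappa>) - 2 * (\<Sum>l. epow \<kappa> (tau0 \<xi> (Suc l) + 1))"
    unfolding sums_unique[OF epow_tau0_sums[OF \<kappa>], symmetric]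
    by (simp add: sums_iff algebra_simps)
  have "S \<kappa> \<xi> x = (\<Sum>n. (1 - 2 * of_bool (digit \<xi> n \<noteq> 0)) * \<kappa> ^ (n + 1))"
    unfolding S_def by (simp add: dPhi_B2_eq[OF assms(4,5)] mult.commute)
  \<comment> \<open>Since digits are 0 or 1, both expressions are the sign of the term.\<close>
  moreover have "of_bool (digit \<xi> n = 0) - of_bool (digit \<xi> n = 1)
      = (1 - 2 * of_bool (digit \<xi> n \<noteq> 0) :: real)" for n
    using binary_expansion_term_le[OF binary_expansion_digit[OF assms(4)], of n]
      le_neq_implies_less[of "digit \<xi> n" 1] by (cases "digit \<xi> n = 0") auto
  ultimately show ?thesis using T by simp
qed

end
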